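(* Let $r\in\{1,2\}$ and let $n$ be an integer with $r\le \lfloor n/2\rfloor-1$. Then the graph $G_{n,r}$ is unmixed.
   Context: For integers $n,r$ with $0\le r\le \lfloor n/2\rfloor-1$, $G_{n,r}$ is the finite simple graph with vertex set $\{x_1,\ldots,x_n\}$ (in cyclic order, indices read modulo $n$) in which each $x_i$ is adjacent to every vertex other than $x_i$ itself and the vertices of $A_i=\{x_{i-r},\ldots,x_{i-1},x_{i+1},\ldots,x_{i+r}\}$. Equivalently, for $i<j$, $x_ix_j$ is an edge iff $r+1\le j-i\le n-(r+1)$. A graph is unmixed if all its minimal (with respect to inclusion) vertex covers have the same cardinality; equivalently, all its maximal (with respect to inclusion) independent sets have the same cardinality. *)

theory Defs
  imports "Graph_Theory.Pair_Digraph" "HOL-Number_Theory.Cong"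
begin

text \<open>
  A finite simple graph is represented, as in the locale \<^locale>\<open>pair_graph\<close>, by its vertex
  set and a symmetric irreflexive set of arcs. Vertices $x_1,\dots,x_n$ are the integers
  $1,\dots,n$; an index read modulo $n$ denotes the vertex in this range congruent to it.
\<close>

definition near :: "int \<Rightarrow> int \<Rightarrow> int \<Rightarrow> int set" where
  "near n r i = {j \<in> {1..n}. \<exists>k. 1 \<le> \<bar>k\<bar> \<and> \<bar>k\<bar> \<le> r \<and> [j = i + k] (mod n)}"

definition G :: "int \<Rightarrow> int \<Rightarrow> int pair_pre_digraph" where
  "G n r = \<lparr> pverts = {1..n},
             parcs = {(i, j). i \<in> {1..n} \<and> j \<in> {1..n} \<and> j \<noteq> i \<and> j \<notin> near n r i} \<rparr>"

definition vertex_cover :: "'a pair_pre_digraph \<Rightarrow> 'a set \<Rightarrow> bool" where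
  "vertex_cover H C \<longleftrightarrow> C \<subseteq> pverts H \<and> (\<forall>(u, v) \<in> parcs H. u \<in> C \<or> v \<in> C)"

definition minimal_vertex_cover :: "'a pair_pre_digraph \<Rightarrow> 'a set \<Rightarrow> bool" where
  "minimal_vertex_cover H C \<longleftrightarrow> vertex_cover H C \<and> (\<forall>D. D \<subset> C \<longrightarrow> \<not> vertex_cover H D)"

definition unmixed :: "'a pair_pre_digraph \<Rightarrow> bool" where
  "unmixed H \<longleftrightarrow>
    (\<forall>C D. minimal_vertex_cover H C \<longrightarrow> minimal_vertex_cover H D \<longrightarrow> card C = card D)"

lemma near_sym:
  assumes "i \<in> {1..n}" "j \<in> near n r i"
  shows "i \<in> near n r j"
proof -
  obtain k where k: "1 \<le> \<bar>k\<bar>" "\<bar>k\<bar> \<le> r" "[j = i + k] (mod n)"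
    using assms(2) by (auto simp: near_def)
  have "[i = j + (- k)] (mod n)"
    using k(3) by (simp add: cong_iff_dvd_diff dvd_diff_commute algebra_simps)
  then show ?thesis
    using assms(1) k unfolding near_def by (auto intro!: exI[of _ "- k"])
qed

lemma pair_graph_G: "pair_graph (G n r)"
proof unfold_locales
  show "finite (parcs (G n r))"
    by (rule finite_subset[of _ "{1..n} \<times> {1..n}"]) (auto simp: G_def)
  have "sym (parcs (G n r))"
    by (rule symI) (auto simp: G_def dest: near_sym[rotated])
  moreover have "arcs_ends (with_proj (G n r)) = parcs (G n r)"
    by simp
  ultimately show "symmetric (with_proj (G n r))"
    unfolding symmetric_def by simp
qed (auto simp: G_def)

lemma arc_G_iff:
  assumes "0 \<le> r" "r \<le> n div 2 - 1" "1 \<le> i" "i < j" "j \<le> n"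
  shows "(i, j) \<in> parcs (G n r) \<longleftrightarrow> r + 1 \<le> j - i \<and> j - i \<le> n - (r + 1)"
proof -
  have "j \<in> near n r i \<longleftrightarrow> j - i \<le> r \<or> n - (j - i) \<le> r"
  proof
    assume "j \<in> near n r i"
    then obtain k where k: "\<bar>k\<bar> \<le> r" "[j = i + k] (mod n)"
      by (auto simp: near_def)
    then obtain m where m: "j - i = k + n * m"
      by (auto simp: cong_iff_dvd_diff dvd_def algebra_simps)
    have b: "0 < j - i" "j - i < n" "2 * r < n" "0 < n"
      using assms by auto
    have "m < 2"
    proof (rule ccontr)
      assume "\<not> m < 2"
      then have "n * 2 \<le> n * m" using b by (intro mult_left_mono) auto
      then show False using m k(1) b by linarith
    qed
    moreover have "m > - 1"
    proof (rule ccontr)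
      assume "\<not> m > - 1"
      then have "n * m \<le> n * (- 1)" using b by (intro mult_left_mono) auto
      then show False using m k(1) b by linarith
    qed
    ultimately have "m = 0 \<or> m = 1" by linarith
    then show "j - i \<le> r \<or> n - (j - i) \<le> r" using m k(1) by auto
  next
    assume "j - i \<le> r \<or> n - (j - i) \<le> r"
    then show "j \<in> near n r i"
    proof
      assume "j - i \<le> r"
      then show ?thesis using assms
        unfolding near_def by (auto intro!: exI[of _ "j - i"])
    next
      assume "n - (j - i) \<le> r"
      then show ?thesis using assms
        unfolding near_def by (auto intro!: exI[of _ "j - i - n"] simp: cong_iff_dvd_diff)
    qed
  qed
  then show ?thesis using assms by (auto simp: G_def)
qed

end

theory Submission
  imports Defs
begin

text \<open>
  Complements of minimal vertex covers are maximal independent sets, and the independent sets of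
  \<^term>\<open>G n r\<close> are the sets of vertices that are pairwise at cyclic distance at most \<^term>\<open>r\<close>.
  For \<^term>\<open>r \<in> {1, 2::int}\<close> such a set never has \<^term>\<open>r + 2\<close> elements, because the cyclic
  gaps between its elements would sum to less than \<^term>\<open>n\<close>, and one with at most \<^term>\<open>r\<close>
  elements can always be enlarged. So all maximal independent sets have size \<^term>\<open>r + 1\<close>.
\<close>

text \<open>For representatives in \<open>{1..n}\<close> this is cyclic distance at most
  \<open>r\<close>: the second disjunct is the way around through \<open>n\<close> and
  \<open>1\<close>. No congruence remains, so linear arithmetic applies.\<close>

definition cyc_close :: "int \<Rightarrow> int \<Rightarrow> int \<Rightarrow> int \<Rightarrow> bool" where
  "cyc_close n r x y \<longleftrightarrow> \<bar>x - y\<bar> \<le> r \<or> n - r \<le> \<bar>x - y\<bar>"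

text \<open>Symmetry of the arcs extends \<open>arc_G_iff\<close> to \<open>y < x\<close>; on the
  diagonal there is no arc, and \<open>0 \<le> r\<close> makes a vertex close to itself.\<close>

lemma arc_G_iff_not_cyc_close:
  assumes "0 \<le> r" "r \<le> n div 2 - 1" "x \<in> {1..n}" "y \<in> {1..n}"
  shows "(x, y) \<in> parcs (G n r) \<longleftrightarrow> \<not> cyc_close n r x y"
proof -
  have sym: "(y, x) \<in> parcs (G n r) \<longleftrightarrow> (x, y) \<in> parcs (G n r)"
    using assms(3,4) by (auto simp: G_def dest: near_sym[rotated])
  consider "x < y" | "x = y" | "y < x" by linarith
  then show ?thesis
  proof cases
    case 1
    then show ?thesis using arc_G_iff[of r n x y] assms by (auto simp: cyc_close_def)
  next
    case 2
    then show ?thesis using assms by (auto simp: cyc_close_def G_def)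
  next
    case 3
    then show ?thesis using arc_G_iff[of r n y x] assms sym by (auto simp: cyc_close_def)
  qed
qed

text \<open>Listing chosen elements in increasing order fixes the sign of every difference inside
  \<open>cyc_close\<close>.\<close>

lemma sorted_elements:
  fixes S :: "int set"
  assumes "finite S" "m \<le> card S"
  obtains xs where "set xs \<subseteq> S" "sorted_wrt (<) xs" "length xs = m"
proof -
  obtain T where T: "T \<subseteq> S" "card T = m" "finite T"
    using obtain_subset_with_card_n[OF assms(2)] by blast
  then show thesis
    using that[of "sorted_list_of_set T"] by simp
qed

lemma card_cyc_close_le:
  assumes r: "r \<in> {1, 2}" "r \<le> n div 2 - 1"
    and S: "S \<subseteq> {1..n}" "\<And>x y. x \<in> S \<Longrightarrow> y \<in> S \<Longrightarrow> cyc_close n r x y"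
  shows "card S \<le> nat r + 1"
proof (rule ccontr)
  assume "\<not> card S \<le> nat r + 1"
  then have "nat r + 2 \<le> card S" by simp
  moreover have "finite S" using S(1) finite_subset by blast
  ultimately obtain xs where
    xs: "set xs \<subseteq> S" "sorted_wrt (<) xs" "length xs = nat r + 2"
    using sorted_elements by blast
  have n: "2 * r + 2 \<le> n" using r(2) by linarith
  from r(1) consider "r = 1" | "r = 2" by auto
  then show False
  proof cases
    case 1
    then obtain a b c where "xs = [a, b, c]"
      using xs(3) by (auto simp: length_Suc_conv numeral_eq_Suc)
    then have m: "a \<in> S" "b \<in> S" "c \<in> S" "a < b" "b < c"
      using xs by auto
    moreover have "1 \<le> a" "c \<le> n" using m S(1) by auto
    \<comment> \<open>Both consecutive differences are at most \<open>n - 2\<close>, so closeness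
      makes them 1. Then \<open>c - a = 2\<close> lies strictly between 1 and \<open>n - 1\<close>,
      as \<open>n \<ge> 4\<close>.\<close>
    ultimately show False
      using S(2)[of a b] S(2)[of b c] S(2)[of a c] 1 n
      unfolding cyc_close_def by linarith
  next
    case 2
    then obtain a b c d where "xs = [a, b, c, d]"
      using xs(3) by (auto simp: length_Suc_conv numeral_eq_Suc)
    then have m: "a \<in> S" "b \<in> S" "c \<in> S" "d \<in> S" "a < b" "b < c" "c < d"
      using xs by auto
    moreover have "1 \<le> a" "d \<le> n" using m S(1) by auto
    \<comment> \<open>Consecutive differences are at most \<open>n - 3\<close>, hence at most 2. If
      \<open>c - a > 2\<close>, then \<open>c - a = n - 2 = 4\<close> and \<open>d - b = 3\<close>,
      which is not close for \<open>n = 6\<close>; \<open>d - b > 2\<close> is symmetric. Otherwise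
      \<open>d - a = 3 < n - 2\<close>.\<close>
    ultimately show False
      using S(2)[of a b] S(2)[of b c] S(2)[of c d] S(2)[of a c] S(2)[of b d] S(2)[of a d] 2 n
      unfolding cyc_close_def by linarith
  qed
qed

lemma cyc_close_extend1:
  assumes "1 \<le> r" "2 \<le> n" "a \<in> {1..n}"
  shows "\<exists>x\<in>{1..n} - {a}. cyc_close n r x a"
\<comment> \<open>The predecessor \<open>a - 1\<close> leaves the vertex range when
  \<open>a = 1\<close>.\<close>
proof (cases "a = 1")
  case True
  then show ?thesis using assms by (intro bexI[of _ 2]) (auto simp: cyc_close_def)
next
  case False
  then show ?thesis using assms by (intro bexI[of _ "a - 1"]) (auto simp: cyc_close_def)
qed

text \<open>At cyclic distance 1 the pair extends to three consecutive vertices; at distance 2 the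
  vertex in between fits. The cases record where the pair sits relative to the passage from
  \<open>n\<close> to \<open>1\<close>.\<close>

lemma cyc_close_extend2:
  assumes "4 \<le> n" "1 \<le> a" "a < b" "b \<le> n" "cyc_close n 2 a b"
  shows "\<exists>x\<in>{1..n} - {a, b}. cyc_close n 2 x a \<and> cyc_close n 2 x b"
proof -
  consider "b = a + 1" "b < n" | "a = n - 1" "b = n" | "b = a + 2"
    | "a = 1" "b = n" | "a = 1" "b = n - 1" | "a = 2" "b = n"
    using assms unfolding cyc_close_def by linarith
  then show ?thesis
  proof cases
    case 1
    then show ?thesis using assms by (intro bexI[of _ "b + 1"]) (auto simp: cyc_close_def)
  next
    case 2
    then show ?thesis using assms by (intro bexI[of _ "n - 2"]) (auto simp: cyc_close_def)
  next
    case 3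
    then show ?thesis using assms by (intro bexI[of _ "a + 1"]) (auto simp: cyc_close_def)
  next
    case 4
    then show ?thesis using assms by (intro bexI[of _ 2]) (auto simp: cyc_close_def)
  next
    case 5
    then show ?thesis using assms by (intro bexI[of _ n]) (auto simp: cyc_close_def)
  next
    case 6
    then show ?thesis using assms by (intro bexI[of _ 1]) (auto simp: cyc_close_def)
  qed
qed

lemma cyc_close_extend:
  assumes r: "r \<in> {1, 2}" "r \<le> n div 2 - 1"
    and S: "S \<subseteq> {1..n}" "\<And>x y. x \<in> S \<Longrightarrow> y \<in> S \<Longrightarrow> cyc_close n r x y"
    and card: "card S \<le> nat r"
  shows "\<exists>x\<in>{1..n} - S. \<forall>y\<in>S. cyc_close n r x y"
proof -
  have n: "2 * r + 2 \<le> n" using r(2) by linarith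
  have fin: "finite S" using S(1) finite_subset by blast
  consider "card S = 0" | "card S = 1" | "card S = 2" "r = 2"
    using card r(1) by fastforce
  then show ?thesis
  proof cases
    case 1
    then show ?thesis using fin n r(1) by (intro bexI[of _ 1]) auto
  next
    case 2
    then obtain a where "S = {a}" by (rule card_1_singletonE)
    then show ?thesis using cyc_close_extend1[of r n a] S(1) n r(1) by auto
  next
    case 3
    then obtain xs where xs: "set xs \<subseteq> S" "sorted_wrt (<) xs" "length xs = 2"
      using sorted_elements[OF fin, of 2] by auto
    then obtain a b where ab: "xs = [a, b]"
      by (auto simp: length_Suc_conv numeral_eq_Suc)
    then have "S = {a, b}" "a < b"
      using xs 3 card_subset_eq[OF fin, of "{a, b}"] by auto
    then show ?thesis
      using cyc_close_extend2[of n a b] S n 3 by auto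
  qed
qed

lemma card_minimal_vertex_cover_G:
  assumes r: "r \<in> {1, 2}" "r \<le> n div 2 - 1"
    and C: "minimal_vertex_cover (G n r) C"
  shows "card C = nat n - (nat r + 1)"
proof -
  define S where "S = {1..n} - C"
  have r0: "0 \<le> r" using r(1) by auto
  have V: "pverts (G n r) = {1..n}" by (simp add: G_def)
  have cover: "vertex_cover (G n r) C" using C by (simp add: minimal_vertex_cover_def)
  then have CV: "C \<subseteq> {1..n}" by (simp add: vertex_cover_def V)
  have SV: "S \<subseteq> {1..n}" by (auto simp: S_def)
  have close: "cyc_close n r x y" if "x \<in> S" "y \<in> S" for x y
    using that cover arc_G_iff_not_cyc_close[OF r0 r(2), of x y]
    by (auto simp: S_def vertex_cover_def)
  have "card S = nat r + 1"
  proof (rule antisym)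
    show "card S \<le> nat r + 1" using card_cyc_close_le[OF r SV close] .
    show "nat r + 1 \<le> card S"
    proof (rule ccontr)
      assume "\<not> nat r + 1 \<le> card S"
      then have "card S \<le> nat r" by simp
      from cyc_close_extend[OF r SV close this]
      obtain x where x: "x \<in> C" "x \<in> {1..n}" "\<forall>y\<in>S. cyc_close n r x y"
        unfolding S_def by blast
      \<comment> \<open>Every arc at \<open>x\<close> ends in a vertex not close to
        \<open>x\<close>, hence outside \<open>S\<close> and so in \<open>C\<close>:
        \<open>x\<close> is redundant in the cover.\<close>
      have "vertex_cover (G n r) (C - {x})"
        unfolding vertex_cover_def
      proof (intro conjI ballI, goal_cases)
        case 1
        then show ?case using CV V by auto
      next
        case (2 e)
        obtain u v where e: "e = (u, v)" by (cases e)
        have uv: "u \<in> {1..n}" "v \<in> {1..n}" "u \<noteq> v" using 2 by (auto simp: e G_def)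
        have "\<not> cyc_close n r u v"
          using 2 arc_G_iff_not_cyc_close[OF r0 r(2) uv(1,2)] by (simp add: e)
        moreover have "cyc_close n r v u = cyc_close n r u v"
          by (simp add: cyc_close_def abs_minus_commute)
        ultimately have "u = x \<Longrightarrow> v \<in> C" "v = x \<Longrightarrow> u \<in> C"
          using x(3) uv by (auto simp: S_def)
        moreover have "u \<in> C \<or> v \<in> C" using cover 2 by (auto simp: e vertex_cover_def)
        ultimately show ?case using uv(3) by (auto simp: e)
      qed
      moreover have "C - {x} \<subset> C" using x(1) by auto
      ultimately show False using C by (simp add: minimal_vertex_cover_def)
    qed
  qed
  moreover have "card S = nat n - card C" "card C \<le> nat n"
    using CV card_mono[OF _ CV] by (auto simp: S_def card_Diff_subset finite_subset)
  ultimately show ?thesis by simp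
qed

theorem lemma3p7:
  fixes n r :: int
  assumes "r \<in> {1, 2}"
    and "r \<le> n div 2 - 1"
  shows "unmixed (G n r)"
  using card_minimal_vertex_cover_G[OF assms] by (simp add: unmixed_def)

end
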